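(* Let $U$ be a Parry numeration system and let $\mathbf{x}$ be a $U$-automatic infinite word over a finite alphabet. Then the factor complexity function $p_{\mathbf{x}}$ of $\mathbf{x}$ is sublinear, that is, $p_{\mathbf{x}}(n)$ is in $\mathcal{O}(1)$ or in $\Theta(n)$.
   Context: Numeration systems. A (positional) numeration system is an increasing sequence $U=(U_n)_{n\ge 0}$ of integers with $U_0=1$ and $C_U:=\sup_{n\ge 0}\lceil U_{n+1}/U_n\rceil<+\infty$. Put $A_U=\{0,\ldots,C_U-1\}$. The greedy representation of a positive integer $n$ is the word $\mathrm{rep}_U(n)=w_{\ell-1}\cdots w_0$ over $A_U$ with $\sum_{i=0}^{\ell-1}w_iU_i=n$, $w_{\ell-1}\neq 0$ and $\sum_{i=0}^{j-1}w_iU_i<U_j$ for all $j\in\{1,\ldots,\ell\}$; $\mathrm{rep}_U(0)=\varepsilon$ is the empty word. Parry numeration systems. Let $\beta>1$ be real. The $\beta$-expansion of $x\in[0,1]$ is the lexicographically greatest sequence $d_\beta(x)=(x_i)_{i\ge1}$ of nonnegative integers with $x=\sum_{i\ge1}x_i\beta^{-i}$. If $d_\beta(1)=t_1\cdots t_m0^\omega$ with $t_m\neq0$, set $d_\beta^*(1)=(t_1\cdots t_{m-1}(t_m-1))^\omega$; otherwise set $d_\beta^*(1)=d_\beta(1)$. The number $\beta$ is a Parry number if $d^*_\beta(1)$ is ultimately periodic. Writing $d_\beta^*(1)=(t_i)_{i\ge1}$, the numeration system $U_\beta=(U_n)_{n\ge0}$ canonically associated with $\beta$ is given by $U_n=t_1U_{n-1}+\cdots+t_nU_0+1$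 for all $n\ge0$. A Parry numeration system is a numeration system $U$ with $U=U_\beta$ for some Parry number $\beta$. Automatic sequences. An infinite word $\mathbf{x}=(x_n)_{n\ge0}$ over a finite alphabet $B$ is $U$-automatic if there is a complete deterministic finite automaton with output $(Q,q_0,A_U,\delta,\tau)$, with transition function $\delta\colon Q\times A_U\to Q$ (extended to words, read from left to right, most significant digit first) and output function $\tau\colon Q\to B$, such that $\delta(q_0,0)=q_0$ and $x_n=\tau(\delta(q_0,\mathrm{rep}_U(n)))$ for all $n\ge0$. Factor complexity. $p_{\mathbf{x}}(n)$ is the number of distinct factors (blocks of consecutive letters) of length $n$ occurring in $\mathbf{x}$. *)

theory Defs
  imports Complex_Main "HOL-Library.Fun_Lexorder" "HOL-Library.Landau_Symbols"
begin

section \<open>Positional numeration systems\<close>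

definition numeration_system :: "(nat \<Rightarrow> nat) \<Rightarrow> bool" where
  "numeration_system U \<longleftrightarrow>
     strict_mono U \<and> U 0 = 1 \<and> bdd_above (range (\<lambda>n. \<lceil>real (U (Suc n)) / real (U n)\<rceil>))"

definition digit_bound :: "(nat \<Rightarrow> nat) \<Rightarrow> int" where
  "digit_bound U = (SUP n. \<lceil>real (U (Suc n)) / real (U n)\<rceil>)"

definition digits :: "(nat \<Rightarrow> nat) \<Rightarrow> nat set" where
  "digits U = {a. int a < digit_bound U}"

text \<open>Words are lists with the most significant digit first, so that the digit of
  weight \<open>U i\<close> in \<open>w\<close> is \<open>rev w ! i\<close>. For \<open>n = 0\<close> the only greedy representation is the
  empty word, since a nonempty one has a nonzero leading digit.\<close>

definition is_greedy_rep :: "(nat \<Rightarrow> nat) \<Rightarrow> nat \<Rightarrow> nat list \<Rightarrow> bool" where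
  "is_greedy_rep U n w \<longleftrightarrow>
     set w \<subseteq> digits U \<and>
     (\<Sum>i<length w. rev w ! i * U i) = n \<and>
     (w \<noteq> [] \<longrightarrow> hd w \<noteq> 0) \<and>
     (\<forall>j\<in>{1..length w}. (\<Sum>i<j. rev w ! i * U i) < U j)"

definition rep :: "(nat \<Rightarrow> nat) \<Rightarrow> nat \<Rightarrow> nat list" where
  "rep U n = (THE w. is_greedy_rep U n w)"


section \<open>Parry numeration systems\<close>

text \<open>A digit sequence \<open>d\<close> is indexed from 0: the digit written \<open>x\<^sub>i\<close> (\<open>i \<ge> 1\<close>) in the
  mathematical literature, of weight \<open>\<beta>\<close> to the power \<open>-i\<close>, is \<open>d (i - 1)\<close>.\<close>

definition represents :: "real \<Rightarrow> real \<Rightarrow> (nat \<Rightarrow> nat) \<Rightarrow> bool" where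
  "represents \<beta> x d \<longleftrightarrow> (\<lambda>i. real (d i) / \<beta> ^ Suc i) sums x"

definition beta_expansion :: "real \<Rightarrow> real \<Rightarrow> (nat \<Rightarrow> nat)" where
  "beta_expansion \<beta> x =
     (THE d. represents \<beta> x d \<and> (\<forall>e. represents \<beta> x e \<longrightarrow> e = d \<or> less_fun e d))"

text \<open>In the finite case, \<open>k = m - 1\<close> is the index of the last nonzero digit \<open>t\<^sub>m\<close>, and the
  resulting sequence has period \<open>m = Suc k\<close>.\<close>

definition is_last_nonzero :: "(nat \<Rightarrow> nat) \<Rightarrow> nat \<Rightarrow> bool" where
  "is_last_nonzero t k \<longleftrightarrow> t k \<noteq> 0 \<and> (\<forall>i>k. t i = 0)"

definition quasi_greedy_expansion :: "real \<Rightarrow> (nat \<Rightarrow> nat)" where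
  "quasi_greedy_expansion \<beta> =
     (let t = beta_expansion \<beta> 1 in
      if \<exists>k. is_last_nonzero t k
      then let k = (THE k. is_last_nonzero t k)
           in (\<lambda>i. if i mod Suc k = k then t k - 1 else t (i mod Suc k))
      else t)"

definition ultimately_periodic :: "(nat \<Rightarrow> 'a) \<Rightarrow> bool" where
  "ultimately_periodic s \<longleftrightarrow> (\<exists>N. \<exists>p>0. \<forall>n\<ge>N. s (n + p) = s n)"

definition Parry_number :: "real \<Rightarrow> bool" where
  "Parry_number \<beta> \<longleftrightarrow> \<beta> > 1 \<and> ultimately_periodic (quasi_greedy_expansion \<beta>)"

fun canonical_system :: "real \<Rightarrow> nat \<Rightarrow> nat" where
  "canonical_system \<beta> n =
     (\<Sum>i<n. quasi_greedy_expansion \<beta> i * canonical_system \<beta> (n - 1 - i)) + 1"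

declare canonical_system.simps [simp del]

definition Parry_numeration_system :: "(nat \<Rightarrow> nat) \<Rightarrow> bool" where
  "Parry_numeration_system U \<longleftrightarrow>
     numeration_system U \<and> (\<exists>\<beta>. Parry_number \<beta> \<and> U = canonical_system \<beta>)"


section \<open>Automatic sequences\<close>

text \<open>Taking states in \<open>nat\<close> is no restriction, since the state set is finite and only
  matters up to renaming.\<close>

definition automatic :: "(nat \<Rightarrow> nat) \<Rightarrow> 'b set \<Rightarrow> (nat \<Rightarrow> 'b) \<Rightarrow> bool" where
  "automatic U B x \<longleftrightarrow>
     (\<exists>(Q :: nat set) q0 \<delta> \<tau>.
        finite Q \<and> q0 \<in> Q \<and>
        (\<forall>q\<in>Q. \<forall>a\<in>digits U. \<delta> q a \<in> Q) \<and>
        (\<forall>q\<in>Q. \<tau> q \<in> B) \<and>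
        \<delta> q0 0 = q0 \<and>
        (\<forall>n. x n = \<tau> (foldl \<delta> q0 (rep U n))))"


section \<open>Factor complexity\<close>

definition factors :: "(nat \<Rightarrow> 'b) \<Rightarrow> nat \<Rightarrow> 'b list set" where
  "factors x n = (\<lambda>i. map x [i..<i + n]) ` UNIV"

definition factor_complexity :: "(nat \<Rightarrow> 'b) \<Rightarrow> nat \<Rightarrow> nat" where
  "factor_complexity x n = card (factors x n)"

end

theory Submission
  imports Defs
begin

text \<open>By Parry's condition on the quasi-greedy expansion \<open>t\<close> of 1, the numbers whose representation
  extends a fixed prefix by \<open>k\<close> digits form an interval, and the part of \<open>x\<close> on it depends only on the
  automaton state and on the tail of \<open>t\<close> matched so far. As \<open>t\<close> is ultimately periodic, \<open>x\<close> is for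
  every \<open>k\<close> a concatenation of boundedly many distinct blocks, whose lengths lie between
  \<open>U (k - J)\<close> and \<open>U k\<close> for a constant \<open>J\<close>. Hence a factor of length at most \<open>U (k - J)\<close> is
  determined by two adjacent blocks and an offset of at most \<open>U k\<close>, which gives a linear upper bound.
  The dichotomy is that of Morse and Hedlund: complexity that is ever stationary is bounded, and
  otherwise it grows by at least one at each step.\<close>

section \<open>Quasi-greedy expansions\<close>

fun greedy_rem :: "real \<Rightarrow> nat \<Rightarrow> real" where
  "greedy_rem \<beta> 0 = 1"
| "greedy_rem \<beta> (Suc n) = frac (\<beta> * greedy_rem \<beta> n)"

definition greedy_digit :: "real \<Rightarrow> nat \<Rightarrow> nat" where
  "greedy_digit \<beta> n = nat \<lfloor>\<beta> * greedy_rem \<beta> n\<rfloor>"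

text \<open>The quasi-greedy expansion is produced by the greedy algorithm with the floor replaced by
  the ceiling minus one, which keeps all remainders positive.\<close>

fun quasi_rem :: "real \<Rightarrow> nat \<Rightarrow> real" where
  "quasi_rem \<beta> 0 = 1"
| "quasi_rem \<beta> (Suc n) = \<beta> * quasi_rem \<beta> n - of_int (\<lceil>\<beta> * quasi_rem \<beta> n\<rceil> - 1)"

definition quasi_digit :: "real \<Rightarrow> nat \<Rightarrow> nat" where
  "quasi_digit \<beta> n = nat (\<lceil>\<beta> * quasi_rem \<beta> n\<rceil> - 1)"

lemma greedy_rem_nonneg: "0 \<le> greedy_rem \<beta> n"
  by (cases n) auto

lemma greedy_rem_le_1: "greedy_rem \<beta> n \<le> 1"
  by (cases n) (auto intro: less_imp_le[OF frac_lt_1])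

lemma greedy_digit_eq: "\<beta> > 1 \<Longrightarrow> of_int \<lfloor>\<beta> * greedy_rem \<beta> n\<rfloor> = real (greedy_digit \<beta> n)"
  using greedy_rem_nonneg[of \<beta> n] by (simp add: greedy_digit_def)

lemma greedy_rem_Suc:
  "\<beta> > 1 \<Longrightarrow> greedy_rem \<beta> (Suc n) = \<beta> * greedy_rem \<beta> n - real (greedy_digit \<beta> n)"
  by (simp add: frac_def greedy_digit_eq)

lemma greedy_partial_sum:
  assumes "\<beta> > 1"
  shows "(\<Sum>i<n. real (greedy_digit \<beta> i) / \<beta> ^ Suc i) = 1 - greedy_rem \<beta> n / \<beta> ^ n"
proof (induction n)
  case (Suc n)
  have "greedy_rem \<beta> (Suc n) / \<beta> ^ Suc n
      = greedy_rem \<beta> n / \<beta> ^ n - real (greedy_digit \<beta> n) / \<beta> ^ Suc n"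
    unfolding greedy_rem_Suc[OF assms] using assms by (simp add: field_simps)
  with Suc show ?case
    by simp
qed simp

lemma represents_greedy_digit:
  assumes "\<beta> > 1"
  shows "represents \<beta> 1 (greedy_digit \<beta>)"
proof -
  have lim: "(\<lambda>n. (1 / \<beta>) ^ n) \<longlonglongrightarrow> 0"
    using assms by (intro LIMSEQ_power_zero) auto
  have "(\<lambda>n. greedy_rem \<beta> n / \<beta> ^ n) \<longlonglongrightarrow> 0"
  proof (rule tendsto_sandwich[OF _ _ tendsto_const lim])
    show "\<forall>\<^sub>F n in sequentially. 0 \<le> greedy_rem \<beta> n / \<beta> ^ n"
      using assms by (simp add: greedy_rem_nonneg)
    show "\<forall>\<^sub>F n in sequentially. greedy_rem \<beta> n / \<beta> ^ n \<le> (1 / \<beta>) ^ n"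
      using assms by (simp add: power_divide divide_right_mono greedy_rem_le_1)
  qed
  then have "(\<lambda>n. 1 - greedy_rem \<beta> n / \<beta> ^ n) \<longlonglongrightarrow> 1 - 0"
    by (intro tendsto_intros)
  then show ?thesis
    unfolding represents_def sums_def by (simp only: greedy_partial_sum[OF assms] diff_zero)
qed

text \<open>At the first index \<open>n\<close> of disagreement, the terms of \<open>e\<close> up to
  \<open>n\<close> sum to at most 1, all terms being nonnegative. So \<open>e n\<close> is at most
  \<beta> times the common remainder, and the greedy digit is the largest such integer.\<close>

lemma greedy_digit_greatest:
  assumes "\<beta> > 1" "represents \<beta> 1 e" "e \<noteq> greedy_digit \<beta>"
  shows "less_fun e (greedy_digit \<beta>)"
proof -
  define n where "n = (LEAST n. e n \<noteq> greedy_digit \<beta> n)"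
  have ne: "e n \<noteq> greedy_digit \<beta> n"
    unfolding n_def using assms(3) LeastI_ex[of "\<lambda>n. e n \<noteq> greedy_digit \<beta> n"] by (simp add: fun_eq_iff)
  have eq: "e i = greedy_digit \<beta> i" if "i < n" for i
    using not_less_Least[of i "\<lambda>n. e n \<noteq> greedy_digit \<beta> n"] that unfolding n_def by simp
  have "(\<Sum>i<Suc n. real (e i) / \<beta> ^ Suc i) \<le> 1"
  proof -
    have sums: "(\<lambda>i. real (e i) / \<beta> ^ Suc i) sums 1"
      using assms(2) unfolding represents_def .
    have "(\<Sum>i<Suc n. real (e i) / \<beta> ^ Suc i) \<le> (\<Sum>i. real (e i) / \<beta> ^ Suc i)"
      using assms(1) by (intro sum_le_suminf sums_summable[OF sums]) simp_all
    also have "\<dots> = 1"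
      using sums by (rule sums_unique[symmetric])
    finally show ?thesis .
  qed
  moreover have "(\<Sum>i<n. real (e i) / \<beta> ^ Suc i) = 1 - greedy_rem \<beta> n / \<beta> ^ n"
    using greedy_partial_sum[OF assms(1), of n] eq by simp
  ultimately have "real (e n) / \<beta> ^ Suc n \<le> greedy_rem \<beta> n / \<beta> ^ n"
    by simp
  then have "real (e n) / \<beta> ^ Suc n * \<beta> ^ Suc n \<le> greedy_rem \<beta> n / \<beta> ^ n * \<beta> ^ Suc n"
    using assms(1) by (intro mult_right_mono) auto
  then have "real (e n) \<le> \<beta> * greedy_rem \<beta> n"
    using assms(1) by (simp add: mult.commute)
  then have "e n \<le> greedy_digit \<beta> n"
    unfolding greedy_digit_def by (simp add: le_nat_floor)
  with ne eq show ?thesis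
    unfolding less_fun_def by (intro exI[of _ n]) auto
qed

lemma beta_expansion_1:
  assumes "\<beta> > 1"
  shows "beta_expansion \<beta> 1 = greedy_digit \<beta>"
  unfolding beta_expansion_def
proof (rule the_equality)
  show "represents \<beta> 1 (greedy_digit \<beta>) \<and>
      (\<forall>e. represents \<beta> 1 e \<longrightarrow> e = greedy_digit \<beta> \<or> less_fun e (greedy_digit \<beta>))"
    using represents_greedy_digit[OF assms] greedy_digit_greatest[OF assms] by auto
next
  fix d
  assume d: "represents \<beta> 1 d \<and> (\<forall>e. represents \<beta> 1 e \<longrightarrow> e = d \<or> less_fun e d)"
  show "d = greedy_digit \<beta>"
  proof (rule ccontr)
    assume ne: "d \<noteq> greedy_digit \<beta>"
    have "less_fun d (greedy_digit \<beta>)"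
      by (rule greedy_digit_greatest[OF assms conjunct1[OF d] ne])
    moreover have "greedy_digit \<beta> = d \<or> less_fun (greedy_digit \<beta>) d"
      using d represents_greedy_digit[OF assms] by simp
    ultimately show False
      using ne less_fun_asym[of d "greedy_digit \<beta>"] by simp
  qed
qed

section \<open>The quasi-greedy algorithm compared with the greedy one\<close>

lemma quasi_rem_bounds: "0 < quasi_rem \<beta> n \<and> quasi_rem \<beta> n \<le> 1"
  by (cases n) (simp, simp, linarith)

lemma quasi_digit_eq:
  assumes "\<beta> > 1"
  shows "real (quasi_digit \<beta> n) = of_int (\<lceil>\<beta> * quasi_rem \<beta> n\<rceil> - 1)"
proof -
  have "0 < \<beta> * quasi_rem \<beta> n"
    using assms quasi_rem_bounds by simp
  then show ?thesis
    unfolding quasi_digit_def by (simp add: less_ceiling_iff)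
qed

lemma quasi_rem_Suc:
  "\<beta> > 1 \<Longrightarrow> quasi_rem \<beta> (Suc n) = \<beta> * quasi_rem \<beta> n - real (quasi_digit \<beta> n)"
  by (simp add: quasi_digit_eq)

lemma quasi_rem_shift:
  assumes "quasi_rem \<beta> m = quasi_rem \<beta> n"
  shows "quasi_rem \<beta> (m + j) = quasi_rem \<beta> (n + j)"
  using assms by (induction j) auto

lemma greedy_digit_eventually_0:
  assumes "greedy_rem \<beta> n = 0" "n \<le> i"
  shows "greedy_digit \<beta> i = 0"
proof -
  have "greedy_rem \<beta> i = 0"
    using assms(2,1) by (induction i rule: dec_induct) auto
  then show ?thesis
    by (simp add: greedy_digit_def)
qed

text \<open>A positive remainder followed only by zero digits would be multiplied by \<beta> at each
  step and eventually exceed 1.\<close>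

lemma greedy_rem_after_last_nonzero:
  assumes "\<beta> > 1" "is_last_nonzero (greedy_digit \<beta>) k"
  shows "greedy_rem \<beta> (Suc k) = 0"
proof (rule ccontr)
  define r where "r = greedy_rem \<beta> (Suc k)"
  assume "greedy_rem \<beta> (Suc k) \<noteq> 0"
  then have "r > 0"
    using greedy_rem_nonneg[of \<beta> "Suc k"] by (simp add: r_def)
  have eq: "greedy_rem \<beta> (Suc k + j) = \<beta> ^ j * r" for j
  proof (induction j)
    case (Suc j)
    have "greedy_digit \<beta> (Suc k + j) = 0"
      using assms(2) by (auto simp: is_last_nonzero_def)
    then show ?case
      using Suc greedy_rem_Suc[OF assms(1), of "Suc k + j"] by simp
  qed (simp add: r_def)
  obtain j where "1 / r < \<beta> ^ j"
    using real_arch_pow[OF assms(1)] by blast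
  then have "1 < \<beta> ^ j * r"
    using \<open>r > 0\<close> by (simp add: field_simps)
  then show False
    using eq[of j] greedy_rem_le_1[of \<beta> "Suc k + j"] by simp
qed

text \<open>If the next greedy remainder is positive, \<beta> times the current one is not an
  integer, and then ceiling minus one equals floor.\<close>

lemma quasi_eq_greedy:
  assumes "\<And>i. i \<le> k \<Longrightarrow> greedy_rem \<beta> i > 0" "i \<le> k"
  shows "quasi_rem \<beta> i = greedy_rem \<beta> i"
  using assms(2)
proof (induction i)
  case (Suc i)
  then have "frac (\<beta> * greedy_rem \<beta> i) > 0"
    using assms(1)[of "Suc i"] by simp
  then have "\<lceil>\<beta> * greedy_rem \<beta> i\<rceil> - 1 = \<lfloor>\<beta> * greedy_rem \<beta> i\<rfloor>"
    by (simp add: ceiling_altdef frac_gt_0_iff) (metis Ints_of_int)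
  then show ?case
    using Suc by (simp add: frac_def)
qed simp

lemma quasi_digit_eq_greedy:
  assumes "\<beta> > 1" "\<And>i. i \<le> k \<Longrightarrow> greedy_rem \<beta> i > 0" "i < k"
  shows "quasi_digit \<beta> i = greedy_digit \<beta> i"
proof -
  have "quasi_rem \<beta> i = greedy_rem \<beta> i" "quasi_rem \<beta> (Suc i) = greedy_rem \<beta> (Suc i)"
    using quasi_eq_greedy[OF assms(2), of k] assms(3) by (simp_all del: quasi_rem.simps greedy_rem.simps)
  then show ?thesis
    using greedy_rem_Suc[OF assms(1)] quasi_rem_Suc[OF assms(1)]
    by (metis add_left_imp_eq diff_add_cancel of_nat_eq_iff)
qed

lemma is_last_nonzero_unique:
  assumes "is_last_nonzero t k" "is_last_nonzero t l"
  shows "k = l"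
proof (cases k l rule: linorder_cases)
  case less
  then show ?thesis
    using assms by (simp add: is_last_nonzero_def)
next
  case greater
  then show ?thesis
    using assms by (simp add: is_last_nonzero_def)
qed

text \<open>If the greedy expansion ends at \<open>k\<close>, both algorithms agree before
  \<open>k\<close>. There \<beta> times the remainder is an integer, so the ceiling rule takes one
  unit less, is left with remainder 1 and starts over, which gives the period \<open>Suc k\<close>.
  Otherwise no greedy remainder vanishes and the algorithms agree forever.\<close>

lemma quasi_greedy_expansion_eq:
  assumes \<beta>: "\<beta> > 1"
  shows "quasi_greedy_expansion \<beta> = quasi_digit \<beta>"
proof (cases "\<exists>k. is_last_nonzero (greedy_digit \<beta>) k")
  case True
  then obtain k where k: "is_last_nonzero (greedy_digit \<beta>) k" ..
  have the_k: "(THE k. is_last_nonzero (greedy_digit \<beta>) k) = k"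
    using k by (rule the_equality[where P = "is_last_nonzero (greedy_digit \<beta>)"])
      (rule is_last_nonzero_unique[OF _ k])
  have pos: "greedy_rem \<beta> i > 0" if "i \<le> k" for i
  proof -
    have "greedy_rem \<beta> i \<noteq> 0"
    proof
      assume "greedy_rem \<beta> i = 0"
      then have "greedy_digit \<beta> k = 0"
        using that by (rule greedy_digit_eventually_0)
      then show False
        using k by (simp add: is_last_nonzero_def)
    qed
    then show ?thesis
      using greedy_rem_nonneg[of \<beta> i] by simp
  qed
  have rem_k: "\<beta> * quasi_rem \<beta> k = real (greedy_digit \<beta> k)"
  proof -
    have "quasi_rem \<beta> k = greedy_rem \<beta> k"
      by (rule quasi_eq_greedy[of k, OF pos]) simp_all
    then have "\<beta> * quasi_rem \<beta> k = \<beta> * greedy_rem \<beta> k"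
      by simp
    then show ?thesis
      using greedy_rem_after_last_nonzero[OF \<beta> k] greedy_rem_Suc[OF \<beta>, of k] by linarith
  qed
  have digit_k: "quasi_digit \<beta> k = greedy_digit \<beta> k - 1"
    unfolding quasi_digit_def rem_k by simp
  have "quasi_rem \<beta> (Suc k) = quasi_rem \<beta> 0"
    by (simp add: rem_k)
  then have per: "quasi_rem \<beta> (Suc k + j) = quasi_rem \<beta> j" for j
    using quasi_rem_shift[of \<beta> "Suc k" 0 j] by simp
  have mult: "quasi_rem \<beta> (m * Suc k + j) = quasi_rem \<beta> j" for m j
  proof (induction m)
    case (Suc m)
    then show ?case
      using per[of "m * Suc k + j"] by (simp add: algebra_simps)
  qed simp
  have "quasi_digit \<beta> i = quasi_digit \<beta> (i mod Suc k)" for i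
    using mult[of "i div Suc k" "i mod Suc k"] unfolding quasi_digit_def by (metis div_mult_mod_eq)
  moreover have "quasi_digit \<beta> i = greedy_digit \<beta> i" if "i < k" for i
    using quasi_digit_eq_greedy[OF \<beta> pos that] by simp
  moreover have "i mod Suc k < k \<or> i mod Suc k = k" for i
    using mod_less_divisor[of "Suc k" i] by linarith
  ultimately have "(\<lambda>i. if i mod Suc k = k then greedy_digit \<beta> k - 1
      else greedy_digit \<beta> (i mod Suc k)) = quasi_digit \<beta>"
    by (intro ext) (metis digit_k)
  then show ?thesis
    unfolding quasi_greedy_expansion_def Let_def beta_expansion_1[OF \<beta>] if_P[OF True] the_k .
next
  case False
  have pos: "greedy_rem \<beta> n > 0" for n
  proof (rule ccontr)
    assume "\<not> greedy_rem \<beta> n > 0"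
    then have zero: "greedy_rem \<beta> n = 0"
      using greedy_rem_nonneg[of \<beta> n] by simp
    \<comment> \<open>The digit just before the first vanishing remainder would be the last nonzero
      one, contrary to the case assumption.\<close>
    define m where "m = (LEAST n. greedy_rem \<beta> n = 0)"
    have m: "greedy_rem \<beta> m = 0"
      unfolding m_def using LeastI[of "\<lambda>n. greedy_rem \<beta> n = 0" n] zero by simp
    then obtain k where k: "m = Suc k"
      by (cases m) auto
    have "greedy_rem \<beta> k \<noteq> 0"
      using not_less_Least[of k "\<lambda>n. greedy_rem \<beta> n = 0"] k unfolding m_def by simp
    moreover have "\<beta> * greedy_rem \<beta> k = real (greedy_digit \<beta> k)"
      using m greedy_rem_Suc[OF \<beta>, of k] unfolding k by linarith
    ultimately have "real (greedy_digit \<beta> k) \<noteq> 0"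
      using \<beta> by (metis less_numeral_extra(3) mult_eq_0_iff not_one_less_zero)
    then have "greedy_digit \<beta> k \<noteq> 0"
      by simp
    moreover have "greedy_digit \<beta> i = 0" if "i > k" for i
      using greedy_digit_eventually_0[OF m] that k by simp
    ultimately show False
      using False unfolding is_last_nonzero_def by blast
  qed
  have "greedy_digit \<beta> i = quasi_digit \<beta> i" for i
    using quasi_digit_eq_greedy[OF \<beta>, of "Suc i" i] pos by simp
  then have "greedy_digit \<beta> = quasi_digit \<beta>" ..
  then show ?thesis
    unfolding quasi_greedy_expansion_def Let_def beta_expansion_1[OF \<beta>] if_not_P[OF False] .
qed

text \<open>Parry's condition: no shift of the quasi-greedy expansion is lexicographically larger than
  the expansion itself.\<close>

lemma quasi_digit_Parry:
  assumes \<beta>: "\<beta> > 1" and "\<And>i. i < r \<Longrightarrow> quasi_digit \<beta> (s + i) = quasi_digit \<beta> i"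
  shows "quasi_digit \<beta> (s + r) \<le> quasi_digit \<beta> r"
proof -
  \<comment> \<open>The comparison starts from
    \<open>quasi_rem \<beta> s \<le> 1 = quasi_rem \<beta> 0\<close>. Equal digits preserve it, and
    the next digit is monotone in the remainder.\<close>
  have "quasi_rem \<beta> (s + r) \<le> quasi_rem \<beta> r"
    using assms(2)
  proof (induction r)
    case 0
    then show ?case
      using quasi_rem_bounds[of \<beta> s] by simp
  next
    case (Suc r)
    then have "\<beta> * quasi_rem \<beta> (s + r) \<le> \<beta> * quasi_rem \<beta> r"
      using \<beta> by simp
    moreover have "quasi_digit \<beta> (s + r) = quasi_digit \<beta> r"
      using Suc.prems by simp
    ultimately show ?case
      unfolding add_Suc_right quasi_rem_Suc[OF \<beta>] by simp
  qed
  then have "\<beta> * quasi_rem \<beta> (s + r) \<le> \<beta> * quasi_rem \<beta> r"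
    using \<beta> by simp
  then show ?thesis
    unfolding quasi_digit_def by (intro nat_mono diff_right_mono ceiling_mono)
qed

text \<open>Zero digits from \<open>s\<close> on would let the positive remainder grow like a power
  of \<beta>. This keeps blocks from being too short in \<open>block_length_lower\<close>.\<close>

lemma quasi_digit_nonzero:
  assumes \<beta>: "\<beta> > 1"
  shows "\<exists>j. quasi_digit \<beta> (s + j) \<noteq> 0"
proof (rule ccontr)
  assume "\<not> ?thesis"
  then have zero: "quasi_digit \<beta> (s + j) = 0" for j
    by simp
  have eq: "quasi_rem \<beta> (s + j) = \<beta> ^ j * quasi_rem \<beta> s" for j
  proof (induction j)
    case (Suc j)
    then show ?case
      unfolding add_Suc_right quasi_rem_Suc[OF \<beta>] zero by simp
  qed simp
  have pos: "quasi_rem \<beta> s > 0"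
    using quasi_rem_bounds by blast
  obtain j where "1 / quasi_rem \<beta> s < \<beta> ^ j"
    using real_arch_pow[OF \<beta>] by blast
  then have "1 < \<beta> ^ j * quasi_rem \<beta> s"
    using pos by (simp add: field_simps)
  then show False
    using eq[of j] quasi_rem_bounds[of \<beta> "s + j"] by simp
qed


section \<open>Factor complexity\<close>

lemma finite_factors:
  assumes "finite (range x)"
  shows "finite (factors x n)"
proof (rule finite_subset)
  show "factors x n \<subseteq> {w. set w \<subseteq> range x \<and> length w = n}"
    by (auto simp: factors_def)
  show "finite {w. set w \<subseteq> range x \<and> length w = n}"
    using finite_lists_length_eq[OF assms] .
qed

lemma take_factors: "m \<le> n \<Longrightarrow> take m ` factors x n = factors x m"
  unfolding factors_def image_image by (simp add: take_map take_upt)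

lemma factor_complexity_mono:
  assumes "finite (range x)" "m \<le> n"
  shows "factor_complexity x m \<le> factor_complexity x n"
  unfolding factor_complexity_def take_factors[OF assms(2), of x, symmetric]
  by (rule card_image_le[OF finite_factors[OF assms(1)]])

text \<open>Truncation from \<open>factors x (Suc n)\<close> onto \<open>factors x n\<close> is
  surjective, hence injective when the cardinalities agree. So each window of length
  \<open>n\<close> determines the next letter, and by induction everything after it.\<close>

lemma factor_complexity_stationary:
  assumes fin: "finite (range x)" and eq: "factor_complexity x (Suc n) = factor_complexity x n"
    and "n \<le> m"
  shows "factor_complexity x m = factor_complexity x n"
proof -
  have "inj_on (take n) (factors x (Suc n))"
    using eq unfolding factor_complexity_def take_factors[of n "Suc n" x, OF le_SucI[OF order_refl], symmetric]
    by (intro eq_card_imp_inj_on finite_factors fin) simp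
  then have ext: "x (i + n) = x (j + n)" if "\<And>l. l < n \<Longrightarrow> x (i + l) = x (j + l)" for i j
  proof -
    have "map x [i..<i + n] = map x [j..<j + n]"
      using that by (intro nth_equalityI) auto
    then have "take n (map x [i..<i + Suc n]) = take n (map x [j..<j + Suc n])"
      by (simp add: take_map take_upt)
    then have "map x [i..<i + Suc n] = map x [j..<j + Suc n]"
      using \<open>inj_on (take n) (factors x (Suc n))\<close> unfolding factors_def inj_on_def by blast
    then show ?thesis
      by simp
  qed
  have all: "x (i + l) = x (j + l)" if "\<And>l. l < n \<Longrightarrow> x (i + l) = x (j + l)" for i j l
  proof (induction l rule: less_induct)
    case (less l)
    show ?case
    proof (cases "l < n")
      case False
      \<comment> \<open>\<open>ext\<close> is the local fact here, not extensionality: the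
        \<open>n\<close> letters before position \<open>l\<close> agree by the induction
        hypothesis.\<close>
      then have "x (i + (l - n) + n) = x (j + (l - n) + n)"
        by (intro ext) (use less[of "l - n + _"] in \<open>simp add: add.assoc\<close>)
      then show ?thesis
        using False by simp
    qed (use that in simp)
  qed
  have "inj_on (take n) (factors x m)"
  proof (rule inj_onI)
    fix u v
    assume "u \<in> factors x m" "v \<in> factors x m" and tk: "take n u = take n v"
    then obtain i j where u: "u = map x [i..<i + m]" and v: "v = map x [j..<j + m]"
      by (auto simp: factors_def)
    have "x (i + l) = x (j + l)" if "l < n" for l
    proof -
      have "take n u ! l = take n v ! l"
        by (simp only: tk)
      then show ?thesis
        using that \<open>n \<le> m\<close> unfolding u v by simp
    qed
    then show "u = v"
      unfolding u v using all[of i j] by (intro nth_equalityI) auto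
  qed
  then show ?thesis
    unfolding factor_complexity_def take_factors[OF \<open>n \<le> m\<close>, of x, symmetric]
    by (simp add: card_image)
qed

lemma factor_complexity_ge:
  assumes fin: "finite (range x)" and "\<And>n. factor_complexity x (Suc n) \<noteq> factor_complexity x n"
  shows "n \<le> factor_complexity x n"
proof (induction n)
  case (Suc n)
  then show ?case
    using factor_complexity_mono[OF fin, of n "Suc n"] assms(2)[of n] by linarith
qed simp

section \<open>Factors of concatenations of few distinct blocks\<close>

text \<open>A window no longer than any block fits into two consecutive blocks. Leading blocks are
  discarded until the window starts inside, or exactly at the end of, the first one.\<close>

lemma factor_of_concat:
  assumes "set bs \<subseteq> S" "\<And>b. b \<in> S \<Longrightarrow> n \<le> length b" "i + n \<le> length (concat bs)" "bs \<noteq> []"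
  shows "\<exists>b\<in>S. \<exists>b'\<in>S. \<exists>j\<le>length b. take n (drop i (concat bs)) = take n (drop j (b @ b'))"
  using assms(1,3,4)
proof (induction bs arbitrary: i)
  case (Cons b bs)
  have b: "b \<in> S"
    using Cons.prems by simp
  show ?case
  proof (cases "bs = []")
    case True
    \<comment> \<open>The window fits into the last block, so the second block is mere padding, and
      \<open>b\<close> itself serves as a member of \<open>S\<close>.\<close>
    then have "take n (drop i (concat (b # bs))) = take n (drop i (b @ b))" "i \<le> length b"
      using Cons.prems by simp_all
    with b show ?thesis
      by blast
  next
    case nonempty: False
    show ?thesis
    proof (cases "i \<le> length b")
      case True
      obtain b' cs where cs: "bs = b' # cs"
        using nonempty by (cases bs) auto
      then have b': "b' \<in> S"
        using Cons.prems by simp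
      have "take n (drop i (concat (b # bs))) = take n (drop i (b @ b'))"
        using assms(2)[OF b'] True by (simp add: cs)
      with b b' True show ?thesis
        by blast
    next
      case False
      then show ?thesis
        using Cons.IH[of "i - length b"] Cons.prems nonempty by simp
    qed
  qed
qed simp

text \<open>Every factor lies in a prefix that splits into blocks, so it is given by two blocks and
  one of the \<open>Suc m\<close> offsets in \<open>{..m}\<close>.\<close>

lemma factor_complexity_concat_le:
  assumes fin: "finite S"
    and len: "\<And>b. b \<in> S \<Longrightarrow> n \<le> length b \<and> length b \<le> m"
    and cover: "\<And>N. \<exists>M\<ge>N. \<exists>bs. set bs \<subseteq> S \<and> map x [0..<M] = concat bs"
  shows "factor_complexity x n \<le> card S * card S * Suc m"
proof -
  define F where "F = (\<lambda>(b, b', j). take n (drop j (b @ b' :: 'a list))) ` (S \<times> S \<times> {..m})"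
  have "factors x n \<subseteq> F"
  proof
    fix w
    assume "w \<in> factors x n"
    then obtain i where w: "w = map x [i..<i + n]"
      by (auto simp: factors_def)
    \<comment> \<open>The extra 1 makes the prefix nonempty even for \<open>i = n = 0\<close>, so
      that \<open>bs\<close> is nonempty.\<close>
    obtain M bs where M: "M \<ge> i + n + 1" "set bs \<subseteq> S" "map x [0..<M] = concat bs"
      using cover by blast
    have length_M: "length (concat bs) = M"
      using arg_cong[OF M(3), of length] by simp
    then have "bs \<noteq> []"
      using M(1) by auto
    then obtain b b' j where b: "b \<in> S" "b' \<in> S" "j \<le> length b"
      "take n (drop i (concat bs)) = take n (drop j (b @ b'))"
      using factor_of_concat[OF M(2), of n i] len length_M M(1) by auto
    have "w = take n (drop i (concat bs))"
      unfolding w M(3)[symmetric] using M(1) by (simp add: take_map drop_map take_upt)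
    then have "w = (\<lambda>(b, b', j). take n (drop j (b @ b'))) (b, b', j)"
      using b(4) by simp
    then show "w \<in> F"
      unfolding F_def using b len[OF b(1)] by (intro image_eqI[of _ _ "(b, b', j)"]) auto
  qed
  moreover have "finite F"
    unfolding F_def using fin by simp
  moreover have "card F \<le> card (S \<times> S \<times> {..m})"
    unfolding F_def using fin by (intro card_image_le) simp
  moreover have "card (S \<times> S \<times> {..m}) = card S * card S * Suc m"
    by (simp only: card_cartesian_product card_atMost mult.assoc)
  ultimately show ?thesis
    unfolding factor_complexity_def using card_mono[of F "factors x n"] by linarith
qed


section \<open>Greedy representations\<close>

text \<open>For \<open>n < U k\<close> this is the greedy representation with leading zeros up to
  length \<open>k\<close>. The fixed length allows a recursion on digits.\<close>

primrec padded_rep :: "(nat \<Rightarrow> nat) \<Rightarrow> nat \<Rightarrow> nat \<Rightarrow> nat list" where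
  "padded_rep U 0 n = []"
| "padded_rep U (Suc k) n = n div U k # padded_rep U k (n mod U k)"

lemma length_padded_rep [simp]: "length (padded_rep U k n) = k"
  by (induction k arbitrary: n) auto

lemma numeration_system_ratio:
  assumes "numeration_system U"
  shows "int a * int (U k) < int (U (Suc k)) \<Longrightarrow> a \<in> digits U"
    and "int (U (Suc k)) \<le> digit_bound U * int (U k)"
proof -
  have pos: "real (U k) > 0"
    using assms strict_mono_mono[of U] monoD[of U 0 k] by (auto simp: numeration_system_def)
  have le: "\<lceil>real (U (Suc k)) / real (U k)\<rceil> \<le> digit_bound U"
    unfolding digit_bound_def using assms by (intro cSUP_upper) (auto simp: numeration_system_def)
  then have "real (U (Suc k)) / real (U k) \<le> of_int (digit_bound U)"
    by (simp add: ceiling_le_iff)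
  then have "real (U (Suc k)) \<le> of_int (digit_bound U) * real (U k)"
    using pos by (simp add: field_simps)
  then show "int (U (Suc k)) \<le> digit_bound U * int (U k)"
    by (metis (mono_tags, lifting) of_int_le_iff of_int_mult of_int_of_nat_eq)
  assume "int a * int (U k) < int (U (Suc k))"
  then have "real a * real (U k) < real (U (Suc k))"
    unfolding of_nat_mult[symmetric] of_nat_less_iff .
  then have "real a < real (U (Suc k)) / real (U k)"
    using pos by (simp add: field_simps)
  then have "int a < \<lceil>real (U (Suc k)) / real (U k)\<rceil>"
    by (simp add: less_ceiling_iff)
  then show "a \<in> digits U"
    using le by (simp add: digits_def)
qed

lemma set_padded_rep:
  assumes "numeration_system U" "n < U k"
  shows "set (padded_rep U k n) \<subseteq> digits U"
  using assms(2)
proof (induction k arbitrary: n)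
  case (Suc k)
  have pos: "U k > 0"
    using assms strict_mono_mono[of U] monoD[of U 0 k] by (auto simp: numeration_system_def)
  have "n div U k * U k < U (Suc k)"
    using Suc.prems div_times_less_eq_dividend[of n "U k"] by linarith
  then have "int (n div U k) * int (U k) < int (U (Suc k))"
    unfolding of_nat_mult[symmetric] of_nat_less_iff .
  then have "n div U k \<in> digits U"
    by (rule numeration_system_ratio(1)[OF assms(1)])
  then show ?case
    using Suc.IH[of "n mod U k"] pos by simp
qed simp

lemma sum_rev_Cons:
  fixes U :: "nat \<Rightarrow> nat"
  assumes "j \<le> length w"
  shows "(\<Sum>i<j. rev (a # w) ! i * U i) = (\<Sum>i<j. rev w ! i * U i)"
  using assms by (intro sum.cong) (auto simp: nth_append)

lemma sum_rev_Cons_all: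
  fixes U :: "nat \<Rightarrow> nat"
  shows "(\<Sum>i<length (a # w). rev (a # w) ! i * U i)
    = a * U (length w) + (\<Sum>i<length w. rev w ! i * U i)"
  using sum_rev_Cons[of "length w" w a U] by (simp add: nth_append)

lemma padded_rep_sum:
  assumes "\<And>k. U k > 0" "U 0 = 1" "n < U k"
  shows "(\<Sum>i<k. rev (padded_rep U k n) ! i * U i) = n"
  using assms(3)
proof (induction k arbitrary: n)
  case (Suc k)
  then show ?case
    using sum_rev_Cons_all[of "n div U k" "padded_rep U k (n mod U k)" U] assms(1) by simp
qed (use assms in simp)

lemma padded_rep_partial_sum:
  assumes "\<And>k. U k > 0" "U 0 = 1" "n < U k" "j \<le> k"
  shows "(\<Sum>i<j. rev (padded_rep U k n) ! i * U i) < U j"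
  using assms(3,4)
proof (induction k arbitrary: n)
  case (Suc k)
  show ?case
  proof (cases "j = Suc k")
    case True
    then show ?thesis
      using padded_rep_sum[OF assms(1,2) Suc.prems(1)] Suc.prems(1) by simp
  next
    case False
    then show ?thesis
      using Suc.IH[of "n mod U k"] Suc.prems assms(1)
        sum_rev_Cons[of j "padded_rep U k (n mod U k)" "n div U k" U] by simp
  qed
qed (use assms in simp)

text \<open>The greedy condition puts the value of the tail below the weight of the leading digit,
  so division with remainder recovers both.\<close>

lemma padded_rep_unique:
  fixes U :: "nat \<Rightarrow> nat"
  assumes "\<And>j. 1 \<le> j \<Longrightarrow> j \<le> length w \<Longrightarrow> (\<Sum>i<j. rev w ! i * U i) < U j" "\<And>k. U k > 0"
  shows "w = padded_rep U (length w) (\<Sum>i<length w. rev w ! i * U i)"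
  using assms(1)
proof (induction w)
  case (Cons a w)
  define n where "n = (\<Sum>i<length w. rev w ! i * U i)"
  have partial: "(\<Sum>i<j. rev w ! i * U i) < U j" if "1 \<le> j" "j \<le> length w" for j
    using Cons.prems[of j] that sum_rev_Cons[of j w a U] by simp
  have "n < U (length w)"
    unfolding n_def using partial[of "length w"] assms(2)[of 0] by (cases w) auto
  then have "(a * U (length w) + n) div U (length w) = a" "(a * U (length w) + n) mod U (length w) = n"
    by simp_all
  moreover have "w = padded_rep U (length w) n"
    unfolding n_def by (rule Cons.IH[OF partial])
  ultimately show ?case
    unfolding sum_rev_Cons_all n_def[symmetric] by simp
qed simp

lemma padded_rep_add:
  assumes "\<And>i j. i \<le> j \<Longrightarrow> U i \<le> U j" "n < U k"
  shows "padded_rep U (d + k) n = replicate d 0 @ padded_rep U k n"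
proof (induction d)
  case (Suc d)
  have "n < U (d + k)"
    using assms(1)[of k "d + k"] assms(2) by simp
  then show ?case
    using Suc by simp
qed simp

text \<open>Minimality of \<open>l n\<close> makes the leading digit nonzero. Conversely a greedy
  word is the padded one of its own length; that length is at least \<open>l n\<close> by the value,
  and a larger one would force a leading 0.\<close>

lemma rep_eq_padded_rep:
  assumes "numeration_system U"
  defines "l \<equiv> (\<lambda>n. LEAST l. n < U l)"
  shows "rep U n = padded_rep U (l n) n"
proof -
  have mono: "strict_mono U" and U0: "U 0 = 1"
    using assms by (auto simp: numeration_system_def)
  have le: "U i \<le> U j" if "i \<le> j" for i j
    using mono that by (simp add: strict_mono_less_eq)
  have pos: "U k > 0" for k
    using le[of 0 k] U0 by simp
  have "n < U (Suc n)"
    using strict_mono_imp_increasing[OF mono, of "Suc n"] by simp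
  then have l: "n < U (l n)"
    unfolding l_def by (rule LeastI[of "\<lambda>l. n < U l"])
  have l_least: "U k \<le> n" if "k < l n" for k
    using not_less_Least[of k "\<lambda>l. n < U l"] that unfolding l_def by simp
  have "is_greedy_rep U n (padded_rep U (l n) n)"
    unfolding is_greedy_rep_def
  proof (intro conjI ballI impI)
    show "set (padded_rep U (l n) n) \<subseteq> digits U"
      by (rule set_padded_rep[OF assms(1) l])
    show "(\<Sum>i<length (padded_rep U (l n) n). rev (padded_rep U (l n) n) ! i * U i) = n"
      using padded_rep_sum[OF pos U0 l] by simp
  next
    assume "padded_rep U (l n) n \<noteq> []"
    then obtain k where k: "l n = Suc k"
      by (cases "l n") auto
    then have "U k \<le> n"
      using l_least by simp
    then show "hd (padded_rep U (l n) n) \<noteq> 0"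
      unfolding k using pos[of k] by (simp add: div_eq_0_iff)
  next
    fix j
    assume "j \<in> {1..length (padded_rep U (l n) n)}"
    then show "(\<Sum>i<j. rev (padded_rep U (l n) n) ! i * U i) < U j"
      using padded_rep_partial_sum[OF pos U0 l, of j] by simp
  qed
  moreover have "w = padded_rep U (l n) n" if "is_greedy_rep U n w" for w
  proof -
    have w: "w = padded_rep U (length w) n"
      using padded_rep_unique[of w U] that pos by (auto simp: is_greedy_rep_def)
    have "n < U (length w)"
    proof (cases "w = []")
      case False
      then have "length w \<in> {1..length w}"
        by (simp add: Suc_le_eq)
      then show ?thesis
        using that unfolding is_greedy_rep_def by blast
    qed (use that U0 in \<open>simp add: is_greedy_rep_def\<close>)
    then have "l n \<le> length w"
      unfolding l_def by (rule Least_le[of "\<lambda>l. n < U l"])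
    moreover have "length w \<le> l n"
    proof (rule ccontr)
      assume "\<not> length w \<le> l n"
      then obtain d where d: "length w = Suc d + l n"
        by (metis add.commute less_imp_Suc_add not_le add_Suc_right)
      then have "w = 0 # replicate d 0 @ padded_rep U (l n) n"
        using w padded_rep_add[of U, OF le l, of "Suc d"] by simp
      then show False
        using that by (auto simp: is_greedy_rep_def)
    qed
    ultimately show ?thesis
      using w by simp
  qed
  ultimately show ?thesis
    unfolding rep_def by (rule the_equality)
qed

text \<open>Leading zeros do not move \<open>q\<close>, so one length \<open>k\<close> serves all
  numbers below \<open>U k\<close>.\<close>

lemma foldl_rep:
  assumes "numeration_system U" "\<delta> q 0 = q" "n < U k"
  shows "foldl \<delta> q (rep U n) = foldl \<delta> q (padded_rep U k n)"
proof -
  define l where "l = (LEAST l. n < U l)"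
  have l: "n < U l" "l \<le> k"
    unfolding l_def using assms(3) LeastI[of "\<lambda>l. n < U l" k] Least_le[of "\<lambda>l. n < U l" k] by simp_all
  have "padded_rep U k n = replicate (k - l) 0 @ padded_rep U l n"
    using padded_rep_add[of U n l "k - l"] l assms(1)
    by (simp add: numeration_system_def strict_mono_less_eq)
  moreover have "foldl \<delta> q (replicate d 0) = q" for d
    by (induction d) (simp_all add: assms(2))
  ultimately show ?thesis
    using rep_eq_padded_rep[OF assms(1), of n] by (simp add: l_def)
qed


section \<open>Block decomposition\<close>

text \<open>\<open>block_length t U s k\<close> is the number of ways to continue by \<open>k\<close> digits a representation
  whose last \<open>s\<close> digits are the first ones of \<open>t\<close>: after a digit below \<open>t s\<close> every greedy tail is allowed,
  while after \<open>t s\<close> itself the tail remains bounded by the remaining digits of \<open>t\<close>.\<close>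

fun block_length :: "(nat \<Rightarrow> nat) \<Rightarrow> (nat \<Rightarrow> nat) \<Rightarrow> nat \<Rightarrow> nat \<Rightarrow> nat" where
  "block_length t U s 0 = 1"
| "block_length t U s (Suc k) = t s * U k + block_length t U (Suc s) k"

text \<open>For \<open>s = 0\<close> the sum has the shape of the recurrence of the canonical
  system. It also isolates single digits for the lower bound.\<close>

lemma block_length_eq_sum:
  "block_length t U s k = (\<Sum>i<k. t (s + i) * U (k - 1 - i)) + 1"
proof (induction k arbitrary: s)
  case (Suc k)
  have "(\<Sum>i<Suc k. t (s + i) * U (Suc k - 1 - i))
      = t s * U k + (\<Sum>i<k. t (Suc s + i) * U (k - 1 - i))"
    by (subst sum.lessThan_Suc_shift) (simp add: diff_commute)
  then show ?case
    using Suc[of "Suc s"] by simp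
qed simp

lemma block_length_0: "block_length (quasi_greedy_expansion \<beta>) (canonical_system \<beta>) 0 k = canonical_system \<beta> k"
  unfolding block_length_eq_sum by (subst (2) canonical_system.simps) simp

lemma block_length_cong:
  assumes "\<And>i. t (s + i) = t (s' + i)"
  shows "block_length t U s k = block_length t U s' k"
  unfolding block_length_eq_sum using assms by simp

text \<open>While the digits agree, the matched prefix grows. At the first smaller digit the
  remaining tail counts at most \<open>U k\<close>, which the missing unit of
  \<open>t (s + r)\<close> compensates. The case \<open>r = 0\<close> bounds every block length by
  \<open>U k\<close>.\<close>

lemma block_length_Parry:
  assumes Parry: "\<And>r s. (\<And>i. i < r \<Longrightarrow> t (s + i) = t i) \<Longrightarrow> t (s + r) \<le> t r"
    and U: "\<And>k. block_length t U 0 k = U k"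
    and "\<And>i. i < r \<Longrightarrow> t (s + i) = t i"
  shows "block_length t U (s + r) k \<le> block_length t U r k"
  using assms(3)
proof (induction k arbitrary: s r)
  case (Suc k)
  have "t (s + r) \<le> t r"
    using Parry Suc.prems by blast
  then consider "t (s + r) = t r" | "t (s + r) < t r"
    by linarith
  then show ?case
  proof cases
    case 1
    then have "block_length t U (s + Suc r) k \<le> block_length t U (Suc r) k"
      using Suc.prems by (intro Suc.IH) (auto simp: less_Suc_eq)
    with 1 show ?thesis
      by simp
  next
    case 2
    have "block_length t U (Suc (s + r)) k \<le> U k"
      using Suc.IH[of 0 "Suc (s + r)"] U by simp
    then have "block_length t U (s + r) (Suc k) \<le> Suc (t (s + r)) * U k"
      by simp
    also have "\<dots> \<le> t r * U k"
      using 2 by (intro mult_right_mono) auto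
    finally show ?thesis
      by simp
  qed
qed simp

lemma map_upt_blocks:
  "map f [0..<a * u + r] = concat (map (\<lambda>b. map (\<lambda>n. f (b * u + n)) [0..<u]) [0..<a])
     @ map (\<lambda>n. f (a * u + n)) [0..<r]"
proof (induction a arbitrary: r)
  case (Suc a)
  have "map f [0..<Suc a * u + r] = map f [0..<a * u + (u + r)]"
    by (simp add: ac_simps)
  also have "\<dots> = concat (map (\<lambda>b. map (\<lambda>n. f (b * u + n)) [0..<u]) [0..<a])
     @ map (\<lambda>n. f (a * u + n)) [0..<u + r]"
    by (rule Suc)
  also have "map (\<lambda>n. f (a * u + n)) [0..<u + r]
      = map (\<lambda>n. f (a * u + n)) [0..<u] @ map (\<lambda>n. f (Suc a * u + n)) [0..<r]"
    by (rule nth_equalityI) (auto simp: nth_append algebra_simps)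
  finally show ?case
    by simp
qed simp

lemma concat_map_concat: "concat (map (\<lambda>a. concat (f a)) xs) = concat (concat (map f xs))"
  by (induction xs) simp_all

text \<open>These are the only properties of the quasi-greedy expansion used in the counting.
  \<open>U_eq\<close> is the recurrence of the canonical system.\<close>

locale Parry_automaton =
  fixes t U :: "nat \<Rightarrow> nat" and Q :: "'q set" and \<delta> :: "'q \<Rightarrow> nat \<Rightarrow> 'q" and \<tau> :: "'q \<Rightarrow> 'b"
  assumes system: "numeration_system U"
    and U_eq: "block_length t U 0 k = U k"
    and Parry: "(\<And>i. i < r \<Longrightarrow> t (s + i) = t i) \<Longrightarrow> t (s + r) \<le> t r"
    and periodic: "ultimately_periodic t"
    and nonzero: "\<exists>j. t (s + j) \<noteq> 0"
    and finite_Q: "finite Q"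
    and \<delta>_closed: "q \<in> Q \<Longrightarrow> a \<in> digits U \<Longrightarrow> \<delta> q a \<in> Q"
begin

lemma U_mono: "i \<le> j \<Longrightarrow> U i \<le> U j"
  using system by (simp add: numeration_system_def strict_mono_less_eq)

lemma block_length_le: "block_length t U s k \<le> U k"
  using block_length_Parry[of t U 0 s k, OF Parry U_eq] U_eq by simp

lemma digit_le: "a \<le> t s \<Longrightarrow> a \<in> digits U"
proof (rule numeration_system_ratio(1)[OF system, of _ 0])
  assume "a \<le> t s"
  then have "a * U 0 \<le> t s * U 0"
    by simp
  \<comment> \<open>A block with \<open>k = 1\<close> has length \<open>t s * U 0 + 1\<close>, which
    is at most \<open>U 1\<close>.\<close>
  also have "\<dots> < U (Suc 0)"
    using block_length_le[of s "Suc 0"] by simp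
  finally show "int a * int (U 0) < int (U (Suc 0))"
    unfolding of_nat_mult[symmetric] of_nat_less_iff .
qed

text \<open>The outputs on the successive \<open>k\<close>-digit continuations of a prefix that
  leads to state \<open>q\<close> and ends with the first \<open>s\<close> digits of
  \<open>t\<close>.\<close>

definition block :: "'q \<Rightarrow> nat \<Rightarrow> nat \<Rightarrow> 'b list" where
  "block q s k = map (\<lambda>n. \<tau> (foldl \<delta> q (padded_rep U k n))) [0..<block_length t U s k]"

definition blocks :: "nat \<Rightarrow> 'b list set" where
  "blocks k = {block q s k | q s. q \<in> Q}"

text \<open>Split by the first digit: below \<open>t s\<close> the rest is free, so matching
  restarts at 0; the digit \<open>t s\<close> extends the match.\<close>

lemma block_Suc:
  "block q s (Suc k)
    = concat (map (\<lambda>a. block (\<delta> q a) 0 k) [0..<t s]) @ block (\<delta> q (t s)) (Suc s) k"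
proof -
  have "block q s (Suc k) = concat (map (\<lambda>a. map (\<lambda>n. \<tau> (foldl \<delta> q (padded_rep U (Suc k) (a * U k + n)))) [0..<U k]) [0..<t s])
     @ map (\<lambda>n. \<tau> (foldl \<delta> q (padded_rep U (Suc k) (t s * U k + n)))) [0..<block_length t U (Suc s) k]"
    unfolding block_def block_length.simps by (rule map_upt_blocks)
  \<comment> \<open>The bound \<open>m \<le> U k\<close> lets division by \<open>U k\<close> return
    the digit \<open>a\<close> and the remainder \<open>n\<close>.\<close>
  moreover have "map (\<lambda>n. \<tau> (foldl \<delta> q (padded_rep U (Suc k) (a * U k + n)))) [0..<m]
      = map (\<lambda>n. \<tau> (foldl \<delta> (\<delta> q a) (padded_rep U k n))) [0..<m]" if "m \<le> U k" for a m
    using that by (intro map_cong) auto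
  ultimately show ?thesis
    unfolding block_def U_eq by (simp only: block_length_le order_refl)
qed

lemma block_decomposition:
  "q \<in> Q \<Longrightarrow> \<exists>bs. set bs \<subseteq> blocks k \<and> block q s (d + k) = concat bs"
proof (induction d arbitrary: q s)
  case 0
  then show ?case
    by (intro exI[of _ "[block q s k]"]) (auto simp: blocks_def)
next
  case (Suc d)
  have closed: "\<delta> q a \<in> Q" if "a \<le> t s" for a
    using \<delta>_closed[OF Suc.prems digit_le[OF that]] .
  have "\<forall>a. \<exists>bs. a \<le> t s \<longrightarrow> set bs \<subseteq> blocks k \<and> block (\<delta> q a) 0 (d + k) = concat bs"
    using Suc.IH closed by blast
  then obtain f where f: "a \<le> t s \<Longrightarrow> set (f a) \<subseteq> blocks k \<and> block (\<delta> q a) 0 (d + k) = concat (f a)" for a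
    by metis
  obtain cs where cs: "set cs \<subseteq> blocks k" "block (\<delta> q (t s)) (Suc s) (d + k) = concat cs"
    using Suc.IH closed by blast
  have "block q s (Suc d + k) = concat (map (\<lambda>a. concat (f a)) [0..<t s]) @ concat cs"
    unfolding add_Suc block_Suc using f cs
    by (intro arg_cong2[of _ _ _ _ append] arg_cong[of _ _ concat] map_cong) auto
  also have "\<dots> = concat (concat (map f [0..<t s]) @ cs)"
    by (simp add: concat_map_concat)
  finally have "block q s (Suc d + k) = concat (concat (map f [0..<t s]) @ cs)" .
  moreover have "set (f a) \<subseteq> blocks k" if "a < t s" for a
    using f[of a] that by simp
  then have "set (concat (map f [0..<t s]) @ cs) \<subseteq> blocks k"
    using cs(1) by (simp add: UN_subset_iff)
  ultimately show ?case
    by blast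
qed

section \<open>Uniform bounds on the number and the lengths of blocks\<close>

lemma finitely_many_tails: "\<exists>M. \<forall>s. \<exists>s'<M. \<forall>i. t (s + i) = t (s' + i)"
proof -
  obtain N p where p: "p > 0" "\<And>n. n \<ge> N \<Longrightarrow> t (n + p) = t n"
    using periodic by (auto simp: ultimately_periodic_def)
  have "\<exists>s'<N + p. \<forall>i. t (s + i) = t (s' + i)" for s
  proof (induction s rule: less_induct)
    case (less s)
    show ?case
    proof (cases "s < N + p")
      case False
      then obtain s' where s': "s' < N + p" "\<And>i. t (s - p + i) = t (s' + i)"
        using less[of "s - p"] p(1) by auto
      have "t (s + i) = t (s' + i)" for i
        using p(2)[of "s - p + i"] s'(2)[of i] False by simp
      with s'(1) show ?thesis
        by blast
    qed blast
  qed
  then show ?thesis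
    by blast
qed

text \<open>For fixed \<open>k\<close>, a block depends only on \<open>q\<close> and on the tail of
  \<open>t\<close> at \<open>s\<close>, so the number of tails gives a bound independent of
  \<open>k\<close>.\<close>

lemma finite_blocks: "\<exists>M. \<forall>k. finite (blocks k) \<and> card (blocks k) \<le> M"
proof -
  obtain M where M: "\<And>s. \<exists>s'<M. \<forall>i. t (s + i) = t (s' + i)"
    using finitely_many_tails by blast
  have sub: "blocks k \<subseteq> (\<lambda>(q, s). block q s k) ` (Q \<times> {..<M})" for k
  proof
    fix b
    assume "b \<in> blocks k"
    then obtain q s where qs: "q \<in> Q" "b = block q s k"
      by (auto simp: blocks_def)
    obtain s' where s': "s' < M" "\<And>i. t (s + i) = t (s' + i)"
      using M by blast
    then have "b = block q s' k"
      using block_length_cong[of t s s' U k] by (simp add: qs block_def)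
    then show "b \<in> (\<lambda>(q, s). block q s k) ` (Q \<times> {..<M})"
      using qs(1) s'(1) by (intro image_eqI[of _ _ "(q, s')"]) auto
  qed
  have fin: "finite (Q \<times> {..<M})"
    using finite_Q by simp
  have "finite (blocks k) \<and> card (blocks k) \<le> card (Q \<times> {..<M})" for k
    using surj_card_le[OF fin sub] finite_surj[OF fin sub] by simp
  then show ?thesis
    by blast
qed

lemma block_length_lower: "\<exists>J. \<forall>s k. U k \<le> block_length t U s (k + J)"
proof -
  obtain M where M: "\<And>s. \<exists>s'<M. \<forall>i. t (s + i) = t (s' + i)"
    using finitely_many_tails by blast
  obtain g where g: "\<And>s. t (s + g s) \<noteq> 0"
    using nonzero by metis
  \<comment> \<open>The sum is a crude common bound for the offsets \<open>g s\<close> of nonzero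
    digits; the \<open>Suc\<close> gives \<open>j < J\<close>, so that
    \<open>k + J - 1 - j \<ge> k\<close>.\<close>
  define J where "J = Suc (\<Sum>s<M. g s)"
  have "U k \<le> block_length t U s (k + J)" for s k
  proof -
    obtain s' where s': "s' < M" "\<And>i. t (s + i) = t (s' + i)"
      using M by blast
    define j where "j = g s'"
    have "g s' \<le> (\<Sum>s<M. g s)"
      using s'(1) by (intro member_le_sum) auto
    then have j: "j < J" "t (s + j) \<noteq> 0"
      using g[of s'] s'(2) by (auto simp: j_def J_def)
    have "U k \<le> U (k + J - 1 - j)"
      using j by (intro U_mono) simp
    also have "\<dots> \<le> t (s + j) * U (k + J - 1 - j)"
      using j by simp
    also have "\<dots> \<le> (\<Sum>i<k + J. t (s + i) * U (k + J - 1 - i))"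
      using j by (intro member_le_sum[of j _ "\<lambda>i. t (s + i) * U (k + J - 1 - i)"]) auto
    finally show ?thesis
      by (simp add: block_length_eq_sum)
  qed
  then show ?thesis
    by blast
qed

lemma U_growth: "U (k + d) \<le> nat (digit_bound U) ^ d * U k"
proof (induction d)
  case (Suc d)
  have "U (Suc (k + d)) \<le> nat (digit_bound U) * U (k + d)"
  proof -
    have "int (U (Suc (k + d))) \<le> digit_bound U * int (U (k + d))"
      by (rule numeration_system_ratio(2)[OF system])
    also have "\<dots> \<le> int (nat (digit_bound U)) * int (U (k + d))"
      by (intro mult_right_mono) auto
    finally show ?thesis
      unfolding of_nat_mult[symmetric] of_nat_le_iff .
  qed
  also have "\<dots> \<le> nat (digit_bound U) * (nat (digit_bound U) ^ d * U k)"
    using Suc by simp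
  finally show ?case
    by (simp add: mult.assoc)
qed simp

lemma factor_complexity_linear:
  assumes q0: "q0 \<in> Q" "\<delta> q0 0 = q0" and x: "\<And>n. x n = \<tau> (foldl \<delta> q0 (rep U n))"
  shows "\<exists>C. \<forall>n\<ge>1. factor_complexity x n \<le> C * n"
proof -
  obtain M where M: "\<And>k. finite (blocks k)" "\<And>k. card (blocks k) \<le> M"
    using finite_blocks by blast
  obtain J where J: "\<And>s k. U k \<le> block_length t U s (k + J)"
    using block_length_lower by blast
  \<comment> \<open>The exponent \<open>Suc J\<close> bridges the gap from \<open>U (k - 1)\<close>
    to \<open>U (k + J)\<close>.\<close>
  define D where "D = nat (digit_bound U) ^ Suc J"
  have U_gt: "n < U (Suc n)" for n
    using system strict_mono_imp_increasing[of U "Suc n"] by (simp add: numeration_system_def)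
  \<comment> \<open>Nothing is matched before the first digit, and \<open>q0\<close> absorbs leading
    zeros.\<close>
  have prefix: "map x [0..<U k] = block q0 0 k" for k
    using foldl_rep[OF system, of \<delta> q0 _ k] q0 by (simp add: block_def U_eq x)
  have cover: "\<exists>m\<ge>N. \<exists>bs. set bs \<subseteq> blocks k \<and> map x [0..<m] = concat bs" for N k
  proof (intro exI[of _ "U (Suc N + k)"] conjI)
    show "N \<le> U (Suc N + k)"
      using U_gt[of N] U_mono[of "Suc N" "Suc N + k"] by linarith
    show "\<exists>bs. set bs \<subseteq> blocks k \<and> map x [0..<U (Suc N + k)] = concat bs"
      unfolding prefix by (rule block_decomposition[OF q0(1)])
  qed
  have bound: "factor_complexity x n \<le> M * M * Suc (U (k + J))" if "n \<le> U k" for n k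
  proof -
    have "factor_complexity x n \<le> card (blocks (k + J)) * card (blocks (k + J)) * Suc (U (k + J))"
    proof (rule factor_complexity_concat_le[OF M(1) _ cover])
      fix b
      assume "b \<in> blocks (k + J)"
      then obtain q s where b: "b = block q s (k + J)"
        by (auto simp: blocks_def)
      then show "n \<le> length b \<and> length b \<le> U (k + J)"
        using that J[of k s] block_length_le[of s "k + J"] by (simp add: block_def)
    qed
    also have "\<dots> \<le> M * M * Suc (U (k + J))"
      using M(2) by (intro mult_mono) auto
    finally show ?thesis .
  qed
  have "factor_complexity x n \<le> M * M * (1 + U J + D) * n" if "n \<ge> 1" for n
  proof -
    \<comment> \<open>If \<open>k > 0\<close>, minimality gives \<open>U (k - 1) \<le> n\<close>,
      hence \<open>U (k + J) \<le> D * n\<close>. For \<open>k = 0\<close> the summand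
      \<open>1 + U J\<close> takes over.\<close>
    define k where "k = (LEAST k. n \<le> U k)"
    have k: "n \<le> U k"
      unfolding k_def using U_gt[of n] LeastI[of "\<lambda>k. n \<le> U k" "Suc n"] by simp
    have "Suc (U (k + J)) \<le> (1 + U J + D) * n"
    proof (cases k)
      case 0
      have "1 + U J \<le> (1 + U J + D) * 1"
        by simp
      also have "\<dots> \<le> (1 + U J + D) * n"
        using that by (intro mult_left_mono) auto
      finally show ?thesis
        using 0 by simp
    next
      case (Suc k')
      then have "U k' \<le> n"
        using not_less_Least[of k' "\<lambda>k. n \<le> U k"] unfolding k_def by simp
      have "U (k + J) \<le> D * U k'"
        using U_growth[of k' "Suc J"] unfolding D_def Suc add_Suc_shift .
      also have "\<dots> \<le> D * n"
        using \<open>U k' \<le> n\<close> by simp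
      finally have "U (k + J) \<le> D * n" .
      moreover have "1 \<le> (1 + U J) * n"
        using that by simp
      ultimately show ?thesis
        by (simp add: algebra_simps)
    qed
    then have "M * M * Suc (U (k + J)) \<le> M * M * ((1 + U J + D) * n)"
      by (intro mult_left_mono) auto
    then have "factor_complexity x n \<le> M * M * ((1 + U J + D) * n)"
      by (rule order_trans[OF bound[OF k]])
    then show ?thesis
      by (simp only: mult.assoc)
  qed
  then show ?thesis
    by blast
qed

end

theorem theorem3p2:
  fixes U :: "nat \<Rightarrow> nat" and B :: "'b set" and x :: "nat \<Rightarrow> 'b"
  assumes "Parry_numeration_system U"
    and "finite B"
    and "automatic U B x"
  shows "(\<lambda>n. real (factor_complexity x n)) \<in> O(\<lambda>_. 1) \<or>
         (\<lambda>n. real (factor_complexity x n)) \<in> \<Theta>(\<lambda>n. real n)"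
proof -
  obtain \<beta> where system: "numeration_system U" and "Parry_number \<beta>"
    and U: "U = canonical_system \<beta>"
    using assms(1) by (auto simp: Parry_numeration_system_def)
  then have \<beta>: "\<beta> > 1" and periodic: "ultimately_periodic (quasi_greedy_expansion \<beta>)"
    by (auto simp: Parry_number_def)
  obtain Q :: "nat set" and q0 \<delta> \<tau> where Q: "finite Q" "q0 \<in> Q"
    "\<And>q a. q \<in> Q \<Longrightarrow> a \<in> digits U \<Longrightarrow> \<delta> q a \<in> Q" "\<And>q. q \<in> Q \<Longrightarrow> \<tau> q \<in> B"
    and q0: "\<delta> q0 0 = q0" and x: "\<And>n. x n = \<tau> (foldl \<delta> q0 (rep U n))"
    using assms(3) unfolding automatic_def by metis
  interpret Parry_automaton "quasi_digit \<beta>" U Q \<delta> \<tau>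
  proof unfold_locales
    show "block_length (quasi_digit \<beta>) U 0 k = U k" for k
      using block_length_0[of \<beta> k] by (simp add: U quasi_greedy_expansion_eq[OF \<beta>])
    show "ultimately_periodic (quasi_digit \<beta>)"
      using periodic by (simp add: quasi_greedy_expansion_eq[OF \<beta>])
  qed (use system Q quasi_digit_nonzero[OF \<beta>] quasi_digit_Parry[OF \<beta>] in auto)
  \<comment> \<open>Greedy digits keep the run inside \<open>Q\<close>, so \<open>x\<close> takes
    values in \<open>B\<close> and has finite range, as the counting lemmas require.\<close>
  have "foldl \<delta> q w \<in> Q" if "q \<in> Q" "set w \<subseteq> digits U" for q w
    using that Q(3) by (induction w arbitrary: q) auto
  then have "x n \<in> B" for n
  proof -
    have "n < U (LEAST l. n < U l)"
      using system strict_mono_imp_increasing[of U "Suc n"] LeastI[of "\<lambda>l. n < U l" "Suc n"]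
      by (simp add: numeration_system_def)
    then have "set (rep U n) \<subseteq> digits U"
      unfolding rep_eq_padded_rep[OF system] by (rule set_padded_rep[OF system])
    then show ?thesis
      unfolding x using \<open>\<And>w q. q \<in> Q \<Longrightarrow> set w \<subseteq> digits U \<Longrightarrow> foldl \<delta> q w \<in> Q\<close> Q by blast
  qed
  then have fin: "finite (range x)"
    using assms(2) by (meson finite_subset image_subsetI)
  show ?thesis
  proof (cases "\<exists>n. factor_complexity x (Suc n) = factor_complexity x n")
    case True
    then obtain n where n: "factor_complexity x (Suc n) = factor_complexity x n" ..
    have "eventually (\<lambda>m. norm (real (factor_complexity x m)) \<le> real (factor_complexity x n) * norm (1::real)) at_top"
      using eventually_ge_at_top[of n]
    proof eventually_elim
      case (elim m)
      then show ?case
        using factor_complexity_stationary[OF fin n elim] by simp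
    qed
    then show ?thesis
      by (intro disjI1 bigoI)
  next
    case False
    obtain C where C: "\<And>n. n \<ge> 1 \<Longrightarrow> factor_complexity x n \<le> C * n"
      using factor_complexity_linear[OF Q(2) q0 x] by blast
    have "(\<lambda>n. real (factor_complexity x n)) \<in> O(\<lambda>n. real n)"
    proof (rule bigoI)
      show "eventually (\<lambda>n. norm (real (factor_complexity x n)) \<le> real C * norm (real n)) at_top"
        using eventually_ge_at_top[of 1]
      proof eventually_elim
        case (elim n)
        then have "real (factor_complexity x n) \<le> real (C * n)"
          using C by (intro of_nat_mono)
        then show ?case
          by simp
      qed
    qed
    moreover have "n \<le> factor_complexity x n" for n
      by (rule factor_complexity_ge[OF fin]) (use False in blast)
    then have "(\<lambda>n. real n) \<in> O(\<lambda>n. real (factor_complexity x n))"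
      by (intro bigoI[of _ 1]) simp
    ultimately show ?thesis
      by (intro disjI2 bigthetaI) (simp_all add: bigomega_iff_bigo)
  qed
qed

end
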